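(* Let $\mathbb{S}$ and $\mathbb{T}$ be algebraic theories such that: (S1) for all $\mathbb S$-terms $s',s''$: if $\emptyset\vdash s'$ and $\Gamma\vdash s'=_{\mathbb S}s''$ then $\emptyset\vdash s''$; (S2) for every $\mathbb S$-term $s'$ and variable $x$: if $\Gamma\vdash s'=_{\mathbb S}x$ then $\{x\}\vdash s'$; (S4) for every $\mathbb S$-term $s'$ with at least one variable there is a substitution $f$ from $\mathrm{var}(s')$ to $\mathbb S$-terms such that for every $x\in\mathrm{var}(s')$, $s'[f(y)/y\neq x]=_{\mathbb S}x$; (T2) for all $\mathbb T$-terms $t',t''$: if $\emptyset\vdash t'$ and $\Gamma\vdash t'=_{\mathbb T}t''$ then $\emptyset\vdash t''$; (T3) for every $\mathbb T$-term $t'$ and variable $x$: if $\Gamma\vdash t'=_{\mathbb T}x$ then $\{x\}\vdash t'$; (T4) $\mathbb T$ has a constant $e_{\mathbb T}$. Suppose there are terms $2\vdash_{\mathbb S}s$ and $2\vdash_{\mathbb T}t$ and constants $e_s$ of $\mathbb S$ and $e_t$ of $\mathbb T$ such that $s(x,e_s)=_{\mathbb S}x=_{\mathbb S}s(e_s,x)$, $s(x,x)=_{\mathbb S}x$, and $t(x,e_t)=_{\mathbb T}x=_{\mathbb T}t(e_t,x)$. Then there exists no composite theory of $\mathbb T$ after $\mathbb S$.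
   Context: An algebraic theory consists of a signature and equations; $=_{\mathbb T}$ is provable equality. $\mathrm{var}(t)$ is the set of variables of $t$; $Y\vdash t$ means $\mathrm{var}(t)\subseteq Y$; $\Gamma$ is an arbitrary context; a constant is a $0$-ary operation. $s'[f(y)/y\neq x]$ substitutes $f(y)$ for every variable $y\neq x$ of $s'$. For theories $\mathbb{S},\mathbb{T}$: $\mathbb{U}$ contains them if its signature contains both signatures and their equations are provable in $\mathbb{U}$; a separated term is $t[s_x/x]$ (simultaneous substitution) with $t$ a $\mathbb{T}$-term with variables in $X$ and $s_x$ $\mathbb{S}$-terms; separated terms $t[s_x/x]$, $t'[s'_{x'}/x']$ are equal modulo $(\mathbb{T},\mathbb{S})$ if there are $f:X\to Y$, $f':X'\to Y$ and $\mathbb{S}$-terms $\bar s_y$ with $t[f(x)/x]=_{\mathbb T}t'[f'(x')/x']$, $s_x=_{\mathbb S}\bar s_{f(x)}$, $s'_{x'}=_{\mathbb S}\bar s_{f'(x')}$; $\mathbb{U}$ is a composite theory of $\mathbb{T}$ after $\mathbb{S}$ if every $\mathbb U$-term is $\mathbb U$-equal to a separated term and any two separated terms $\mathbb U$-equal to a common term are equal modulo $(\mathbb{T},\mathbb{S})$. *)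

theory Defs
  imports Main
begin

datatype (syms: 'f, vars: 'v) trm = Var 'v | Op 'f "('f, 'v) trm list"

primrec subst :: "('v \<Rightarrow> ('f, 'w) trm) \<Rightarrow> ('f, 'v) trm \<Rightarrow> ('f, 'w) trm" where
  "subst \<sigma> (Var x) = \<sigma> x"
| "subst \<sigma> (Op g ts) = Op g (map (subst \<sigma>) ts)"

text \<open>An operation symbol is a name together with its arity, so a signature is a set of such
  pairs and inclusion of signatures preserves arities. The type \<^typ>\<open>'f\<close> is only a
  universe of names; a signature need not exhaust it. The fixed countable supply of variables
  is \<^typ>\<open>nat\<close>.\<close>

type_synonym 'f signature = "('f \<times> nat) set"

record 'f alg_theory =
  sig :: "'f signature"
  axs :: "(('f, nat) trm \<times> ('f, nat) trm) set"

fun sig_term :: "'f signature \<Rightarrow> ('f, 'v) trm \<Rightarrow> bool" where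
  "sig_term \<Sigma> (Var x) = True"
| "sig_term \<Sigma> (Op g ts) = ((g, length ts) \<in> \<Sigma> \<and> (\<forall>t \<in> set ts. sig_term \<Sigma> t))"

abbreviation is_term :: "'f alg_theory \<Rightarrow> ('f, nat) trm \<Rightarrow> bool" where
  "is_term T \<equiv> sig_term (sig T)"

definition algebraic_theory :: "'f alg_theory \<Rightarrow> bool" where
  "algebraic_theory T \<longleftrightarrow> (\<forall>(l, r) \<in> axs T. is_term T l \<and> is_term T r)"

text \<open>Provable equality. Every term occurring in a derivation is a term over the signature of
  the theory. There is no variable context in the judgement: terms are provably equal here iff
  they are so in some context containing their variables.\<close>

inductive provable :: "'f alg_theory \<Rightarrow> ('f, nat) trm \<Rightarrow> ('f, nat) trm \<Rightarrow> bool"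
  for T :: "'f alg_theory" where
  axiom: "(l, r) \<in> axs T \<Longrightarrow> is_term T l \<Longrightarrow> is_term T r \<Longrightarrow> provable T l r"
| refl: "is_term T t \<Longrightarrow> provable T t t"
| sym: "provable T t u \<Longrightarrow> provable T u t"
| trans: "provable T t u \<Longrightarrow> provable T u v \<Longrightarrow> provable T t v"
| cong: "(g, length ts) \<in> sig T \<Longrightarrow> list_all2 (provable T) ts us \<Longrightarrow> provable T (Op g ts) (Op g us)"
| subst: "provable T t u \<Longrightarrow> (\<And>x. is_term T (\<sigma> x)) \<Longrightarrow> provable T (subst \<sigma> t) (subst \<sigma> u)"

definition is_constant :: "'f alg_theory \<Rightarrow> 'f \<Rightarrow> bool" where
  "is_constant T c \<longleftrightarrow> (c, 0) \<in> sig T"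

abbreviation const :: "'f \<Rightarrow> ('f, nat) trm" where
  "const c \<equiv> Op c []"

text \<open>A binary term is a term in the two-variable context \<open>{0, 1}\<close>; \<open>app2 s a b\<close> is \<open>s(a, b)\<close>.\<close>

definition binary_term :: "'f alg_theory \<Rightarrow> ('f, nat) trm \<Rightarrow> bool" where
  "binary_term T s \<longleftrightarrow> is_term T s \<and> vars s \<subseteq> {0, 1}"

definition app2 :: "('f, nat) trm \<Rightarrow> ('f, nat) trm \<Rightarrow> ('f, nat) trm \<Rightarrow> ('f, nat) trm" where
  "app2 s a b = subst (\<lambda>i. if i = 0 then a else b) s"

definition contains_theory :: "'f alg_theory \<Rightarrow> 'f alg_theory \<Rightarrow> bool" where
  "contains_theory U T \<longleftrightarrow> sig T \<subseteq> sig U \<and> (\<forall>(l, r) \<in> axs T. provable U l r)"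

text \<open>\<open>separated T S X t s\<close>: the data \<open>(t, (s\<^sub>x))\<close> with \<open>x \<in> X\<close> form a separated term, whose
  underlying term is \<open>subst s t\<close>. The values of \<open>s\<close> outside \<open>X\<close> are irrelevant.\<close>

definition separated ::
  "'f alg_theory \<Rightarrow> 'f alg_theory \<Rightarrow> nat set \<Rightarrow> ('f, nat) trm \<Rightarrow> (nat \<Rightarrow> ('f, nat) trm) \<Rightarrow> bool" where
  "separated T S X t s \<longleftrightarrow> is_term T t \<and> vars t \<subseteq> X \<and> (\<forall>x \<in> X. is_term S (s x))"

definition equal_modulo ::
  "'f alg_theory \<Rightarrow> 'f alg_theory
    \<Rightarrow> nat set \<Rightarrow> ('f, nat) trm \<Rightarrow> (nat \<Rightarrow> ('f, nat) trm)
    \<Rightarrow> nat set \<Rightarrow> ('f, nat) trm \<Rightarrow> (nat \<Rightarrow> ('f, nat) trm) \<Rightarrow> bool" where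
  "equal_modulo T S X t s X' t' s' \<longleftrightarrow>
    (\<exists>Y f f' sb. f ` X \<subseteq> Y \<and> f' ` X' \<subseteq> Y \<and> (\<forall>y \<in> Y. is_term S (sb y))
      \<and> provable T (subst (\<lambda>x. Var (f x)) t) (subst (\<lambda>x. Var (f' x)) t')
      \<and> (\<forall>x \<in> X. provable S (s x) (sb (f x)))
      \<and> (\<forall>x' \<in> X'. provable S (s' x') (sb (f' x'))))"

text \<open>\<open>composite_theory U T S\<close>: \<open>U\<close> is a composite theory of \<open>T\<close> after \<open>S\<close>.\<close>

definition composite_theory :: "'f alg_theory \<Rightarrow> 'f alg_theory \<Rightarrow> 'f alg_theory \<Rightarrow> bool" where
  "composite_theory U T S \<longleftrightarrow>
    algebraic_theory U \<and> contains_theory U S \<and> contains_theory U T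
    \<and> (\<forall>u. is_term U u \<longrightarrow> (\<exists>X t s. separated T S X t s \<and> provable U u (subst s t)))
    \<and> (\<forall>u X t s X' t' s'. is_term U u
        \<and> separated T S X t s \<and> separated T S X' t' s'
        \<and> provable U u (subst s t) \<and> provable U u (subst s' t')
        \<longrightarrow> equal_modulo T S X t s X' t' s')"

end

theory Submission
  imports Defs
begin

text \<open>
  In a composite theory a constant \<open>e\<close> of \<open>T\<close> is a zero for all \<open>S\<close>-terms: by (S4) a term
  \<open>v[e/x]\<close> becomes \<open>e\<close> after substituting suitable \<open>S\<close>-terms for the other variables, and by
  (T2) this forces the outer part of a separated form of \<open>v[e/x]\<close> to be closed already.

  Take a separated form \<open>t'[s\<^sub>i/i]\<close> of \<open>s(t(a,b),t(c,d))\<close>. Setting \<open>b\<close> and \<open>c\<close> to \<open>e\<^sub>t\<close> turns the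
  term into \<open>s(a,d)\<close> and every \<open>s\<^sub>i\<close> containing \<open>b\<close> or \<open>c\<close> into \<open>e\<^sub>t\<close>, so some \<open>s\<^sub>i\<close> is \<open>S\<close>-equal to
  \<open>s(a,d)\<close>. Identifying \<open>c = a\<close> and \<open>d = b\<close> instead gives \<open>t(a,b)\<close> by idempotence, while that
  \<open>s\<^sub>i\<close> becomes \<open>s(a,b)\<close>, which is neither \<open>a\<close> nor \<open>b\<close>. In the resulting \<open>T\<close>-equation between
  renamings of \<open>t'\<close> and \<open>t\<close>, replacing everything but the variable of this \<open>s\<^sub>i\<close> by \<open>e\<^sub>t\<close> makes
  one side closed and the other not, against (T2).
\<close>

section \<open>Substitution and provable equality\<close>

lemma vars_subst: "vars (subst \<sigma> t) = (\<Union>x\<in>vars t. vars (\<sigma> x))"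
  by (induction t) auto

lemma finite_vars: "finite (vars t)"
  by (induction t) auto

lemma subst_cong_vars: "(\<And>x. x \<in> vars t \<Longrightarrow> \<sigma> x = \<tau> x) \<Longrightarrow> subst \<sigma> t = subst \<tau> t"
  by (induction t) auto

lemma subst_subst: "subst \<sigma> (subst \<tau> t) = subst (\<lambda>x. subst \<sigma> (\<tau> x)) t"
  by (induction t) auto

lemma subst_Var: "subst Var t = t"
  by (induction t) (auto simp: map_idI)

lemma sig_term_subst:
  "sig_term \<Sigma> t \<Longrightarrow> (\<And>x. x \<in> vars t \<Longrightarrow> sig_term \<Sigma> (\<sigma> x)) \<Longrightarrow> sig_term \<Sigma> (subst \<sigma> t)"
  by (induction t) auto

lemma sig_term_mono: "sig_term \<Sigma> t \<Longrightarrow> \<Sigma> \<subseteq> \<Sigma>' \<Longrightarrow> sig_term \<Sigma>' t"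
  by (induction t) auto

lemma provable_is_term: "provable T t u \<Longrightarrow> is_term T t \<and> is_term T u"
proof (induction rule: provable.induct)
  case (cong g ts us)
  then show ?case
    by (auto simp: list_all2_conv_all_nth in_set_conv_nth)
qed (auto intro: sig_term_subst)

lemma provable_mono:
  assumes "contains_theory U T" and "provable T t u"
  shows "provable U t u"
  using assms(2)
proof (induction rule: provable.induct)
  case (axiom l r)
  then show ?case using assms(1) by (auto simp: contains_theory_def)
next
  case (refl t)
  then show ?case using assms(1)
    by (auto simp: contains_theory_def intro: provable.refl sig_term_mono)
next
  case (cong g ts us)
  then show ?case using assms(1)
    by (auto simp: contains_theory_def list_all2_conv_all_nth intro!: provable.cong)
next
  case (subst t u \<sigma>)
  then show ?case using assms(1)
    by (auto simp: contains_theory_def intro!: provable.subst intro: sig_term_mono)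
qed (blast intro: provable.sym provable.trans)+

lemma provable_subst_pointwise:
  assumes "is_term T t" and "\<And>x. x \<in> vars t \<Longrightarrow> provable T (\<sigma> x) (\<tau> x)"
  shows "provable T (subst \<sigma> t) (subst \<tau> t)"
  using assms
proof (induction t)
  case (Op g ts)
  have "provable T (subst \<sigma> u) (subst \<tau> u)" if "u \<in> set ts" for u
    using that Op.prems by (intro Op.IH) auto
  then show ?case
    using Op.prems by (auto simp: list_all2_conv_all_nth intro!: provable.cong)
qed simp

lemma provable_substI:
  assumes "provable T t u" and "\<And>x. is_term T (\<sigma> x)"
    and "t' = subst \<sigma> t" and "u' = subst \<sigma> u"
  shows "provable T t' u'"
  using assms provable.subst by blast

section \<open>Binary terms and their unit and idempotence laws\<close>

lemma subst_app2: "subst \<sigma> (app2 s a b) = app2 s (subst \<sigma> a) (subst \<sigma> b)"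
  by (auto simp: app2_def subst_subst intro: subst_cong_vars)

lemma vars_app2:
  "vars s = {0, 1} \<Longrightarrow> vars (app2 s a b) = vars a \<union> vars b"
  by (auto simp: app2_def vars_subst)

lemma is_term_app2:
  "is_term T s \<Longrightarrow> is_term T a \<Longrightarrow> is_term T b \<Longrightarrow> is_term T (app2 s a b)"
  by (simp add: app2_def sig_term_subst)

lemma provable_app2:
  assumes "is_term T s" and "provable T a a'" and "provable T b b'"
  shows "provable T (app2 s a b) (app2 s a' b')"
  using assms by (auto simp: app2_def intro: provable_subst_pointwise)

lemma provable_app2_unit:
  assumes "provable T (app2 s (Var 0) (const e)) (Var 0)" and "is_term T a"
  shows "provable T (app2 s a (const e)) a"
  using assms by (auto intro: provable_substI[where \<sigma> = "\<lambda>_. a"] simp: subst_app2)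

lemma provable_app2_unit':
  assumes "provable T (app2 s (const e) (Var 0)) (Var 0)" and "is_term T a"
  shows "provable T (app2 s (const e) a) a"
  using assms by (auto intro: provable_substI[where \<sigma> = "\<lambda>_. a"] simp: subst_app2)

lemma provable_app2_idem:
  assumes "provable T (app2 s (Var 0) (Var 0)) (Var 0)" and "is_term T a"
  shows "provable T (app2 s a a) a"
  using assms by (auto intro: provable_substI[where \<sigma> = "\<lambda>_. a"] simp: subst_app2)

lemma is_term_const: "is_constant T e \<Longrightarrow> is_term T (const e)"
  by (simp add: is_constant_def)

text \<open>If one of the two variables were missing from \<open>s\<close>, putting \<open>e\<close>
  for the other would leave a closed term equal to a variable, against (S1).\<close>

lemma unital_vars:
  fixes s :: "('f, nat) trm"
  assumes S1: "\<And>s' s''. is_term S s' \<Longrightarrow> is_term S s'' \<Longrightarrow> vars s' = {} \<Longrightarrow> provable S s' s'' \<Longrightarrow> vars s'' = {}"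
    and s: "binary_term S s"
    and r: "provable S (app2 s (Var 0) (const e)) (Var 0)"
    and l: "provable S (app2 s (const e) (Var 0)) (Var 0)"
  shows "vars s = {0, 1}"
proof -
  have "vars (app2 s (Var 0) (const e)) \<noteq> {}" "vars (app2 s (const e) (Var 0)) \<noteq> {}"
    using S1[OF _ _ _ r] S1[OF _ _ _ l] provable_is_term[OF r] provable_is_term[OF l] by auto
  then have "0 \<in> vars s" "1 \<in> vars s"
    using s by (auto simp: app2_def vars_subst binary_term_def split: if_splits)
  then show ?thesis using s by (auto simp: binary_term_def)
qed

section \<open>Composite theories and absorption by constants of \<open>T\<close>\<close>

lemma composite_theoryD:
  assumes "composite_theory U T S"
  shows "contains_theory U S" "contains_theory U T"
    and "is_term S a \<Longrightarrow> is_term U a" and "is_term T a \<Longrightarrow> is_term U a"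
  using assms by (auto simp: composite_theory_def contains_theory_def intro: sig_term_mono)

lemma composite_separated:
  assumes "composite_theory U T S" and "is_term U u"
  obtains X t s where "separated T S X t s" and "provable U u (subst s t)"
  using assms unfolding composite_theory_def by blast

lemma composite_equal_modulo:
  assumes "composite_theory U T S" and "separated T S X t s" and "separated T S X' t' s'"
    and eq: "provable U (subst s t) (subst s' t')"
  shows "equal_modulo T S X t s X' t' s'"
proof -
  have "is_term U (subst s t)" using provable_is_term[OF eq] by blast
  then show ?thesis
    using assms provable.refl[of U "subst s t"] unfolding composite_theory_def by blast
qed

lemma equal_moduloE:
  assumes "equal_modulo T S X t s X' t' s'"
  obtains f f' sb where "provable T (subst (\<lambda>x. Var (f x)) t) (subst (\<lambda>x. Var (f' x)) t')"
    and "\<And>x. x \<in> X \<Longrightarrow> provable S (s x) (sb (f x))"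
    and "\<And>x. x \<in> X' \<Longrightarrow> provable S (s' x) (sb (f' x))"
  using assms unfolding equal_modulo_def
  by (elim exE conjE) (rule that, assumption, (erule (1) bspec)+)

text \<open>The side condition \<open>x \<notin> vars (\<phi> y)\<close> lets the substitution of \<open>e\<close> for \<open>x\<close> commute with
  \<open>\<phi>\<close> without introducing \<open>e\<close> into the \<open>S\<close>-terms \<open>\<phi> y\<close>.\<close>

lemma constant_absorbs_projectable:
  assumes U: "composite_theory U T S"
    and T2: "\<And>t' t''. is_term T t' \<Longrightarrow> is_term T t'' \<Longrightarrow> vars t' = {} \<Longrightarrow> provable T t' t'' \<Longrightarrow> vars t'' = {}"
    and e: "is_constant T e" and v: "is_term S v"
    and \<phi>: "\<And>y. is_term S (\<phi> y)" "\<phi> x = Var x" "\<And>y. y \<in> vars v \<Longrightarrow> y \<noteq> x \<Longrightarrow> x \<notin> vars (\<phi> y)"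
    and proj: "provable S (subst \<phi> v) (Var x)"
  shows "provable U (subst (Var(x := const e)) v) (const e)"
proof -
  let ?\<epsilon> = "Var(x := const e)"
  note UD = composite_theoryD[OF U]
  have \<epsilon>: "is_term U (?\<epsilon> y)" for y
    using UD(4)[OF is_term_const[OF e]] by simp
  obtain X t r where sep: "separated T S X t r" and eq: "provable U (subst ?\<epsilon> v) (subst r t)"
    using composite_separated[OF U] sig_term_subst[OF UD(3)[OF v]] \<epsilon> by metis
  have "subst \<phi> (?\<epsilon> y) = subst ?\<epsilon> (\<phi> y)" if "y \<in> vars v" for y
  proof (cases "y = x")
    case False
    then have "subst ?\<epsilon> (\<phi> y) = subst Var (\<phi> y)"
      using \<phi>(3)[OF that] by (intro subst_cong_vars) auto
    then show ?thesis using False by (simp add: subst_Var)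
  qed (simp add: \<phi>)
  then have comm: "subst \<phi> (subst ?\<epsilon> v) = subst ?\<epsilon> (subst \<phi> v)"
    unfolding subst_subst by (rule subst_cong_vars)
  have "provable U (subst ?\<epsilon> (subst \<phi> v)) (const e)"
    by (rule provable_substI[OF provable_mono[OF UD(1) proj], of ?\<epsilon>]) (rule \<epsilon>, simp_all)
  moreover have "provable U (subst \<phi> (subst ?\<epsilon> v)) (subst (\<lambda>i. subst \<phi> (r i)) t)"
    by (rule provable_substI[OF eq UD(3)[OF \<phi>(1)]]) (simp_all add: subst_subst)
  ultimately have "provable U (subst Var (const e)) (subst (\<lambda>i. subst \<phi> (r i)) t)"
    unfolding comm subst_Var by (blast intro: provable.sym provable.trans)
  \<comment> \<open>The constant needs no \<open>S\<close>-terms, so the index set is empty and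
    \<open>Var\<close> is a mere filler.\<close>
  moreover have "separated T S {} (const e) Var"
    using is_term_const[OF e] by (simp add: separated_def)
  moreover have "separated T S X t (\<lambda>i. subst \<phi> (r i))"
    using sep \<phi>(1) by (auto simp: separated_def intro: sig_term_subst)
  ultimately have "equal_modulo T S {} (const e) Var X t (\<lambda>i. subst \<phi> (r i))"
    using composite_equal_modulo[OF U] by blast
  then obtain g where g: "provable T (const e) (subst (\<lambda>x. Var (g x)) t)"
    by (auto elim: equal_moduloE)
  then have "vars (subst (\<lambda>x. Var (g x)) t) = {}"
    using T2[OF _ _ _ g] provable_is_term[OF g] by simp
  then have "vars t = {}" by (simp add: vars_subst)
  \<comment> \<open>All substitutions agree on a closed \<open>t\<close>, so \<open>g\<close>
    already equates \<open>const e\<close> with the separated form found before \<phi> was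
    applied.\<close>
  then have "subst (\<lambda>x. Var (g x)) t = subst r t"
    by (intro subst_cong_vars) auto
  then show ?thesis
    using eq provable_mono[OF UD(2) g] by (metis provable.sym provable.trans)
qed

text \<open>The term supplied by (S4) for \<open>y \<noteq> x\<close> may contain \<open>x\<close> (for \<open>v\<close> idempotent, it could be \<open>x\<close>
  itself). Adjoining two fresh variables through \<open>s\<close> rules this out, because (S2) then applies
  to the projection to a third variable; they are removed afterwards by setting them to \<open>e\<^sub>s\<close>.\<close>

lemma constant_absorbs:
  fixes v :: "('f, nat) trm"
  assumes U: "composite_theory U T S"
    and S1: "\<And>s' s''. is_term S s' \<Longrightarrow> is_term S s'' \<Longrightarrow> vars s' = {} \<Longrightarrow> provable S s' s'' \<Longrightarrow> vars s'' = {}"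
    and S2: "\<And>s' x. is_term S s' \<Longrightarrow> provable S s' (Var x) \<Longrightarrow> vars s' \<subseteq> {x}"
    and S4: "\<And>s'. is_term S s' \<Longrightarrow> vars s' \<noteq> {} \<Longrightarrow>
      \<exists>f. (\<forall>y \<in> vars s'. is_term S (f y))
        \<and> (\<forall>x \<in> vars s'. provable S (subst (\<lambda>y. if y \<noteq> x then f y else Var y) s') (Var x))"
    and T2: "\<And>t' t''. is_term T t' \<Longrightarrow> is_term T t'' \<Longrightarrow> vars t' = {} \<Longrightarrow> provable T t' t'' \<Longrightarrow> vars t'' = {}"
    and s: "binary_term S s" and es: "is_constant S e\<^sub>s"
    and sr: "provable S (app2 s (Var 0) (const e\<^sub>s)) (Var 0)"
    and sl: "provable S (app2 s (const e\<^sub>s) (Var 0)) (Var 0)"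
    and e: "is_constant T e" and v: "is_term S v" and x: "x \<in> vars v"
    and \<sigma>: "\<And>y. is_term U (\<sigma> y)" "\<sigma> x = const e"
  shows "provable U (subst \<sigma> v) (const e)"
proof -
  note UD = composite_theoryD[OF U]
  have vs: "vars s = {0, 1}" by (rule unital_vars[OF _ s sr sl]) (fact S1)
  have sT: "is_term S s" using s by (simp add: binary_term_def)
  obtain z where z: "z \<notin> vars v"
    using ex_new_if_finite[OF _ finite_vars] infinite_UNIV_nat by blast
  obtain z' where z': "z' \<notin> insert z (vars v)"
    using ex_new_if_finite[of "insert z (vars v)"] finite_vars infinite_UNIV_nat by blast
  define w where "w = app2 s (app2 s v (Var z)) (Var z')"
  have w: "is_term S w" by (simp add: w_def is_term_app2 sT v)
  have vw: "vars w = insert z (insert z' (vars v))"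
    by (auto simp: w_def vars_app2[OF vs])
  then have "vars w \<noteq> {}" by simp
  from S4[OF w this] obtain f where "\<forall>y \<in> vars w. is_term S (f y)"
    and "\<forall>x \<in> vars w. provable S (subst (\<lambda>y. if y \<noteq> x then f y else Var y) w) (Var x)"
    by (elim exE conjE)
  then have f: "\<And>y. y \<in> vars w \<Longrightarrow> is_term S (f y)"
    and proj: "\<And>x. x \<in> vars w \<Longrightarrow> provable S (subst (\<lambda>y. if y \<noteq> x then f y else Var y) w) (Var x)"
    by blast+
  \<comment> \<open>(S4) speaks only about the variables of \<open>w\<close>; the identity elsewhere
    makes every value of \<phi> an \<open>S\<close>-term.\<close>
  define \<phi> where "\<phi> y = (if y \<in> vars w \<and> y \<noteq> x then f y else Var y)" for y
  have fresh: "x \<notin> vars (f y)" if y: "y \<in> vars w" "y \<noteq> x" for y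
  proof -
    \<comment> \<open>Since \<open>x\<close>, \<open>z\<close> and \<open>z'\<close> are distinct
      variables of \<open>w\<close>, at least one is neither \<open>x\<close> nor \<open>y\<close>.
      Projecting to it keeps \<open>f y\<close> in the result, so (S2) bounds the variables of
      \<open>f y\<close>.\<close>
    obtain x' where x': "x' \<in> vars w" "x' \<noteq> x" "x' \<noteq> y"
      using x z z' vw that[of z] that[of z'] by (cases "y = z") auto
    have "vars (subst (\<lambda>y. if y \<noteq> x' then f y else Var y) w) \<subseteq> {x'}"
      using S2[OF _ proj[OF x'(1)]] provable_is_term[OF proj[OF x'(1)]] by blast
    then have "vars (f y) \<subseteq> {x'}"
      using y(1) x'(3) by (fastforce simp: vars_subst)
    then show ?thesis using x'(2) by blast
  qed
  have "subst \<phi> w = subst (\<lambda>y. if y \<noteq> x then f y else Var y) w"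
    by (rule subst_cong_vars) (simp add: \<phi>_def)
  then have "provable S (subst \<phi> w) (Var x)" using proj x vw by simp
  note absorbs = constant_absorbs_projectable[OF U _ e w _ _ _ this]
  have absorbed: "provable U (subst (Var(x := const e)) w) (const e)"
    by (rule absorbs) (fact T2 | simp add: \<phi>_def f fresh)+
  \<comment> \<open>As \<open>z\<close> and \<open>z'\<close> do not occur in \<open>v\<close>,
    overriding \<sigma> there leaves its instance of \<open>v\<close> alone, and the value
    \<open>e\<^sub>s\<close> lets the right unit law strip both layers of \<open>w\<close>.\<close>
  define \<tau> where "\<tau> = \<sigma>(z := const e\<^sub>s, z' := const e\<^sub>s)"
  have \<tau>: "is_term U (\<tau> y)" for y
    using \<sigma>(1) UD(3)[OF is_term_const[OF es]] by (simp add: \<tau>_def)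
  have "provable U (subst \<tau> (subst (Var(x := const e)) w)) (const e)"
    by (rule provable_substI[OF absorbed, of \<tau>]) (rule \<tau>, simp_all)
  moreover have "subst \<tau> (subst (Var(x := const e)) v) = subst \<sigma> v"
    unfolding subst_subst using z z' \<sigma>(2) by (intro subst_cong_vars) (auto simp: \<tau>_def)
  then have "subst \<tau> (subst (Var(x := const e)) w)
      = app2 s (app2 s (subst \<sigma> v) (const e\<^sub>s)) (const e\<^sub>s)"
    using z z' x by (auto simp: w_def subst_app2 \<tau>_def)
  moreover have "provable U (app2 s (app2 s (subst \<sigma> v) (const e\<^sub>s)) (const e\<^sub>s)) (subst \<sigma> v)"
  proof -
    have \<sigma>v: "is_term U (subst \<sigma> v)" using UD(3)[OF v] \<sigma>(1) by (simp add: sig_term_subst)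
    have unit: "provable U (app2 s a (const e\<^sub>s)) a" if "is_term U a" for a
      using provable_app2_unit[OF provable_mono[OF UD(1) sr] that] .
    have "is_term U (app2 s (subst \<sigma> v) (const e\<^sub>s))"
      using provable_is_term[OF unit[OF \<sigma>v]] by blast
    from provable.trans[OF unit[OF this] unit[OF \<sigma>v]] show ?thesis .
  qed
  ultimately show ?thesis by (metis provable.sym provable.trans)
qed

theorem theorem4p21:
  fixes S T :: "'f alg_theory"
    and s t :: "('f, nat) trm"
    and e\<^sub>s e\<^sub>t :: 'f
  assumes "algebraic_theory S" and "algebraic_theory T"
    and S1: "\<And>s' s''. is_term S s' \<Longrightarrow> is_term S s'' \<Longrightarrow> vars s' = {} \<Longrightarrow> provable S s' s'' \<Longrightarrow> vars s'' = {}"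
    and S2: "\<And>s' x. is_term S s' \<Longrightarrow> provable S s' (Var x) \<Longrightarrow> vars s' \<subseteq> {x}"
    and S4: "\<And>s'. is_term S s' \<Longrightarrow> vars s' \<noteq> {} \<Longrightarrow>
      \<exists>f. (\<forall>y \<in> vars s'. is_term S (f y))
        \<and> (\<forall>x \<in> vars s'. provable S (subst (\<lambda>y. if y \<noteq> x then f y else Var y) s') (Var x))"
    and T2: "\<And>t' t''. is_term T t' \<Longrightarrow> is_term T t'' \<Longrightarrow> vars t' = {} \<Longrightarrow> provable T t' t'' \<Longrightarrow> vars t'' = {}"
    and T3: "\<And>t' x. is_term T t' \<Longrightarrow> provable T t' (Var x) \<Longrightarrow> vars t' \<subseteq> {x}"
    and T4: "\<exists>e. is_constant T e"
    and "binary_term S s" and "binary_term T t"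
    and "is_constant S e\<^sub>s" and "is_constant T e\<^sub>t"
    and "\<And>x. provable S (app2 s (Var x) (const e\<^sub>s)) (Var x)"
    and "\<And>x. provable S (app2 s (const e\<^sub>s) (Var x)) (Var x)"
    and "\<And>x. provable S (app2 s (Var x) (Var x)) (Var x)"
    and "\<And>x. provable T (app2 t (Var x) (const e\<^sub>t)) (Var x)"
    and "\<And>x. provable T (app2 t (const e\<^sub>t) (Var x)) (Var x)"
  shows "\<not> (\<exists>U :: 'f alg_theory. composite_theory U T S)"
proof
  assume "\<exists>U :: 'f alg_theory. composite_theory U T S"
  then obtain U :: "'f alg_theory" where U: "composite_theory U T S" by blast
  note s = \<open>binary_term S s\<close> and t = \<open>binary_term T t\<close>
    and es = \<open>is_constant S e\<^sub>s\<close> and et = \<open>is_constant T e\<^sub>t\<close>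
  note sr = assms(13)[of 0] and sl = assms(14)[of 0] and si = assms(15)[of 0]
    and tr = assms(16)[of 0] and tl = assms(17)[of 0]
  note UD = composite_theoryD[OF U]
  have sT: "is_term S s" "is_term U s" and tT: "is_term T t" "is_term U t"
    using s t UD by (auto simp: binary_term_def)
  have etT: "is_term T (const e\<^sub>t)" "is_term U (const e\<^sub>t)"
    using is_term_const[OF et] UD(4) by blast+
  have vs: "vars s = {0, 1}" by (rule unital_vars[OF _ s sr sl]) (fact S1)
  have vt: "vars t \<subseteq> {0, 1}" using t by (simp add: binary_term_def)

  \<comment> \<open>The variables 0, 1, 2, 3 stand for a, b, c, d.\<close>
  define W where "W = app2 s (app2 t (Var 0) (Var 1)) (app2 t (Var 2) (Var 3))"
  have W: "is_term U W" by (simp add: W_def is_term_app2 sT tT)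
  obtain X t' r where sep: "separated T S X t' r" and Weq: "provable U W (subst r t')"
    using composite_separated[OF U W] .
  have t': "is_term T t'" and vX: "vars t' \<subseteq> X" and rT: "\<And>i. i \<in> X \<Longrightarrow> is_term S (r i)"
    using sep by (auto simp: separated_def)

  obtain i where i: "i \<in> vars t'" "provable S (r i) (app2 s (Var 0) (Var 3))"
  proof -
    define \<rho> :: "nat \<Rightarrow> ('f, nat) trm" where "\<rho> = Var(1 := const e\<^sub>t, 2 := const e\<^sub>t)"
    have \<rho>: "is_term U (\<rho> y)" for y using etT by (simp add: \<rho>_def)
    \<comment> \<open>An \<open>S\<close>-term may contain both 1 and 2, which \<rho> replaces
      together, hence the need for absorption with arbitrary values at the other variables.\<close>
    have absorb: "provable U (subst \<rho> v) (const e\<^sub>t)"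
      if "is_term S v" "x \<in> vars v" "\<rho> x = const e\<^sub>t" for v x
      by (rule constant_absorbs[OF U _ _ _ _ s es sr sl et, where x = x and \<sigma> = \<rho>])
        (fact S1 S2 S4 T2 \<rho> that)+
    \<comment> \<open>\<open>I\<close> collects the indices whose \<open>S\<close>-terms are
      absorbed. Moving the resulting constants into the outer part gives \<open>q\<close>; the
      remaining \<open>r i\<close> avoid 1 and 2, so \<rho> fixes them and \<open>q\<close> with the
      unchanged \<open>r\<close> is again a separated term.\<close>
    define I where "I = {i. vars (r i) \<inter> {1, 2} \<noteq> {}}"
    define q where "q = subst (\<lambda>i. if i \<in> I then const e\<^sub>t else Var i) t'"
    have "subst \<rho> W = app2 s (app2 t (Var 0) (const e\<^sub>t)) (app2 t (const e\<^sub>t) (Var 3))"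
      by (simp add: W_def subst_app2 \<rho>_def)
    then have "provable U (subst \<rho> W) (app2 s (Var 0) (Var 3))"
      using provable_app2_unit[OF provable_mono[OF UD(2) tr], of "Var 0"]
        provable_app2_unit'[OF provable_mono[OF UD(2) tl], of "Var 3"]
      by (auto intro: provable_app2[OF sT(2)])
    moreover have "provable U (subst \<rho> W) (subst (\<lambda>i. subst \<rho> (r i)) t')"
      by (rule provable_substI[OF Weq \<rho>]) (simp_all add: subst_subst)
    moreover have "provable U (subst (\<lambda>i. subst \<rho> (r i)) t') (subst r q)"
      unfolding q_def subst_subst
    proof (rule provable_subst_pointwise[OF UD(4)[OF t']])
      fix i assume "i \<in> vars t'"
      then have ri: "is_term S (r i)" using vX rT by blast
      show "provable U (subst \<rho> (r i)) (subst r (if i \<in> I then const e\<^sub>t else Var i))"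
      proof (cases "i \<in> I")
        case True
        then obtain x where "x \<in> vars (r i)" "\<rho> x = const e\<^sub>t"
          by (auto simp: I_def \<rho>_def)
        then have "provable U (subst \<rho> (r i)) (const e\<^sub>t)"
          using absorb[OF ri] by blast
        then show ?thesis using True by simp
      next
        case False
        then have "subst \<rho> (r i) = subst Var (r i)"
          by (intro subst_cong_vars) (auto simp: I_def \<rho>_def)
        then show ?thesis using False UD(3)[OF ri] by (simp add: subst_Var provable.refl)
      qed
    qed
    ultimately have "provable U (subst r q) (subst (\<lambda>_. app2 s (Var 0) (Var 3)) (Var 0))"
      by (metis provable.sym provable.trans subst.simps(1))
    moreover have "separated T S X q r"
      using t' vX rT etT
      by (auto simp: separated_def q_def vars_subst intro!: sig_term_subst split: if_splits)
    \<comment> \<open>The \<open>S\<close>-term s(a,d) is read as a separated term whose outer part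
      is a single variable.\<close>
    moreover have "separated T S {0} (Var 0) (\<lambda>_. app2 s (Var 0) (Var 3))"
      by (simp add: separated_def is_term_app2 sT)
    ultimately have "equal_modulo T S X q r {0} (Var 0) (\<lambda>_. app2 s (Var 0) (Var 3))"
      using composite_equal_modulo[OF U] by blast
    then obtain f f' sb
      where "provable T (subst (\<lambda>x. Var (f x)) q) (subst (\<lambda>x. Var (f' x)) (Var (0::nat)))"
      and rf: "\<And>x. x \<in> X \<Longrightarrow> provable S (r x) (sb (f x))"
      and "\<And>x::nat. x \<in> {0} \<Longrightarrow> provable S (app2 s (Var 0) (Var 3)) (sb (f' x))"
      by (rule equal_moduloE) blast
    then have q: "provable T (subst (\<lambda>x. Var (f x)) q) (Var (f' 0))"
      and sf: "provable S (app2 s (Var 0) (Var 3)) (sb (f' 0))"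
      by simp_all
    \<comment> \<open>By (T2) \<open>q\<close> is not closed, and by (T3) \<open>f\<close> sends all
      its variables to \<open>f' 0\<close>. So \<open>r i\<close> and s(a,d) are equal to the same
      value of \<open>sb\<close>.\<close>
    have "vars (subst (\<lambda>x. Var (f x)) q) \<noteq> {}"
      using T2[OF _ _ _ q] provable_is_term[OF q] by auto
    then obtain i where i: "i \<in> vars q" by (auto simp: vars_subst)
    have "vars (subst (\<lambda>x. Var (f x)) q) \<subseteq> {f' 0}"
      using T3[OF _ q] provable_is_term[OF q] by blast
    then have "f i = f' 0" using i by (auto simp: vars_subst)
    moreover have "i \<in> vars t'" using i by (auto simp: q_def vars_subst split: if_splits)
    ultimately show ?thesis
      using that rf[of i] sf vX by (metis provable.sym provable.trans subsetD)
  qed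

  define \<mu> :: "nat \<Rightarrow> ('f, nat) trm" where "\<mu> = Var(2 := Var 0, 3 := Var 1)"
  have \<mu>: "is_term \<Theta> (\<mu> y)" for \<Theta> :: "'f alg_theory" and y by (simp add: \<mu>_def)
  have "subst \<mu> W = app2 s (app2 t (Var 0) (Var 1)) (app2 t (Var 0) (Var 1))"
    by (simp add: W_def subst_app2 \<mu>_def)
  then have "provable U (subst \<mu> W) (app2 t (Var 0) (Var 1))"
    using provable_app2_idem[OF provable_mono[OF UD(1) si]] by (simp add: is_term_app2 tT)
  moreover have "app2 t (Var 0) (Var 1) = subst Var t"
    unfolding app2_def using vt by (intro subst_cong_vars) auto
  moreover have "provable U (subst \<mu> W) (subst (\<lambda>i. subst \<mu> (r i)) t')"
    by (rule provable_substI[OF Weq \<mu>]) (simp_all add: subst_subst)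
  ultimately have "provable U (subst (\<lambda>i. subst \<mu> (r i)) t') (subst Var t)"
    by (metis provable.sym provable.trans)
  moreover have "separated T S X t' (\<lambda>i. subst \<mu> (r i))"
    using t' vX rT \<mu> by (auto simp: separated_def intro: sig_term_subst)
  \<comment> \<open>The term \<open>t\<close> is its own separated form, with variables as inner
    \<open>S\<close>-terms.\<close>
  moreover have "separated T S {0, 1} t Var"
    using tT vt by (simp add: separated_def)
  ultimately have "equal_modulo T S X t' (\<lambda>i. subst \<mu> (r i)) {0, 1} t Var"
    using composite_equal_modulo[OF U] by blast
  then obtain f f' sb where eq: "provable T (subst (\<lambda>x. Var (f x)) t') (subst (\<lambda>x. Var (f' x)) t)"
    and rf: "\<And>x. x \<in> X \<Longrightarrow> provable S (subst \<mu> (r x)) (sb (f x))"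
    and sf: "\<And>x. x \<in> {0, 1} \<Longrightarrow> provable S (Var x) (sb (f' x))"
    by (rule equal_moduloE) blast
  have "provable S (subst \<mu> (r i)) (app2 s (Var 0) (Var 1))"
    by (rule provable_substI[OF i(2), of \<mu>]) (rule \<mu>, simp_all add: subst_app2 \<mu>_def)
  then have sab: "provable S (app2 s (Var 0) (Var 1)) (sb (f i))"
    using rf[of i] i(1) vX by (metis provable.sym provable.trans subsetD)
  \<comment> \<open>Otherwise s(a,b), which contains both a and b, would be \<open>S\<close>-equal
    to a variable, against (S2).\<close>
  have fi: "f i \<noteq> f' x" if x: "x \<in> {0, 1}" for x
  proof
    assume "f i = f' x"
    then have "provable S (app2 s (Var 0) (Var 1)) (Var x)"
      using sab sf[OF x] by (metis provable.sym provable.trans)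
    then have "vars (app2 s (Var 0) (Var 1)) \<subseteq> {x}"
      using S2 provable_is_term by blast
    then show False by (auto simp: vars_app2[OF vs])
  qed
  \<comment> \<open>The variable \<open>f i\<close> is kept because it occurs in the renamed
    \<open>t'\<close> but, by \<open>fi\<close>, not in the renamed \<open>t\<close>. The equation
    is reversed so that (T2) carries closedness from the side of \<open>t\<close> to that of
    \<open>t'\<close>.\<close>
  let ?\<epsilon> = "\<lambda>y. if y = f i then Var y else const e\<^sub>t"
  have eq': "provable T (subst (\<lambda>x. ?\<epsilon> (f' x)) t) (subst (\<lambda>x. ?\<epsilon> (f x)) t')"
    by (rule provable_substI[OF provable.sym[OF eq], where \<sigma> = ?\<epsilon>])
      (use etT in \<open>auto simp: subst_subst\<close>)
  have "f' x \<noteq> f i" if "x \<in> vars t" for x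
    using fi[of x] vt that by auto
  then have "vars (subst (\<lambda>x. ?\<epsilon> (f' x)) t) = {}"
    by (simp add: vars_subst)
  then have "vars (subst (\<lambda>x. ?\<epsilon> (f x)) t') = {}"
    using T2[OF _ _ _ eq'] provable_is_term[OF eq'] by blast
  then show False using i(1) by (auto simp: vars_subst)
qed

end
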